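(* Let $D\subset\mathbb{R}^n$ be a closed disk. There is a constant $c_1=c_1(D)>0$ such that for every $f\in\mathcal{C}^1(D,\mathbb{R})$ with regular zero set $Z(f)\subset\mathrm{int}(D)$, $$b(Z(f))\le c_1\cdot\left(\kappa_1(f,D)\right)^n.$$
   Context: $Z(f)=\{x\in D:f(x)=0\}$; it is regular if $\nabla f(x)\ne0$ for every $x\in Z(f)$. $b(Z)$ is the sum of the Betti numbers of $Z$. For $f\in\mathcal{C}^1(D,\mathbb{R})$ put $$\nu_1(f,D)=\sup_{x\in D}\left(|f(x)|^2+\|\nabla f(x)\|^2\right)^{1/2},\quad\delta(f,D)=\inf_{x\in D}\left(|f(x)|^2+\|\nabla f(x)\|^2\right)^{1/2},\quad m(f,D)=\min_{x\in\partial D}|f(x)|,$$ $$\kappa_1(f,D)=\frac{\nu_1(f,D)}{\min\{m(f,D),\delta(f,D)\}}.$$ *)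

theory Defs
  imports "HOL-Analysis.Analysis" "HOL-Homology.Homology"
begin

section \<open>Betti numbers\<close>

text \<open>The rank of a (multiplicatively written) abelian group is the supremum of the
  cardinalities of its finite \<open>\<int>\<close>-linearly independent subsets; it may be infinite.\<close>

definition int_independent :: "('a, 'b) monoid_scheme \<Rightarrow> 'a set \<Rightarrow> bool" where
  "int_independent G S \<longleftrightarrow>
     finite S \<and> S \<subseteq> carrier G \<and>
     (\<forall>c :: 'a \<Rightarrow> int. finprod G (\<lambda>x. x [^]\<^bsub>G\<^esub> c x) S = \<one>\<^bsub>G\<^esub> \<longrightarrow> (\<forall>x\<in>S. c x = 0))"

definition abelian_rank :: "('a, 'b) monoid_scheme \<Rightarrow> enat" where
  "abelian_rank G = (SUP S \<in> {S. int_independent G S}. enat (card S))"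

definition betti_number :: "nat \<Rightarrow> 'a topology \<Rightarrow> enat" where
  "betti_number p X = abelian_rank (homology_group (int p) X)"

definition betti_sum :: "'a::topological_space set \<Rightarrow> enat" where
  "betti_sum Z = suminf (\<lambda>p. betti_number p (top_of_set Z))"

section \<open>Continuously differentiable functions on a closed disk\<close>

text \<open>The gradient is taken within \<open>D\<close>, so that on the boundary of the disk only values of
  \<open>f\<close> on \<open>D\<close> matter; the lemma \<open>gradient_within_unique\<close> shows that it is
  well defined.\<close>

definition gradient_within :: "'a::euclidean_space set \<Rightarrow> ('a \<Rightarrow> real) \<Rightarrow> 'a \<Rightarrow> 'a" where
  "gradient_within D f x = (THE g. (f has_derivative (\<lambda>h. g \<bullet> h)) (at x within D))"

lemma gradient_within_unique:
  fixes a x :: "'a::euclidean_space"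
  assumes r: "0 < r" and x: "x \<in> cball a r"
    and g: "(f has_derivative (\<lambda>h. g \<bullet> h)) (at x within cball a r)"
  shows "gradient_within (cball a r) f x = g"
  unfolding gradient_within_def
proof (rule the_equality)
  show "(f has_derivative (\<lambda>h. g \<bullet> h)) (at x within cball a r)"
    by (rule g)
next
  fix g' assume g': "(f has_derivative (\<lambda>h. g' \<bullet> h)) (at x within cball a r)"
  define w where "w = g' - g"
  have d: "((\<lambda>y. 0) has_derivative (\<lambda>h. w \<bullet> h)) (at x within cball a r)"
    using has_derivative_diff[OF g' g] by (simp add: w_def inner_diff_left)
  have orth: "w \<bullet> (v - x) = 0" if v: "v \<in> cball a r" for v
  proof -
    let ?p = "\<lambda>t::real. x + t *\<^sub>R (v - x)"
    have img: "?p ` {0..1} \<subseteq> cball a r"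
    proof
      fix y assume "y \<in> ?p ` {0..1}"
      then obtain t where t: "0 \<le> t" "t \<le> 1" and y: "y = (1 - t) *\<^sub>R x + t *\<^sub>R v"
        by (auto simp: algebra_simps)
      show "y \<in> cball a r"
        unfolding y using t convexD[OF convex_cball x v] by simp
    qed
    have p: "(?p has_derivative (\<lambda>t. t *\<^sub>R (v - x))) (at 0 within {0..1})"
      by (auto intro!: derivative_eq_intros)
    have "((\<lambda>y. 0) has_derivative (\<lambda>h. w \<bullet> h)) (at (?p 0) within ?p ` {0..1})"
      using has_derivative_subset[OF d img] by simp
    from has_derivative_in_compose[OF p this]
    have "((\<lambda>t. 0) has_derivative (\<lambda>t. t * (w \<bullet> (v - x)))) (at 0 within {0..1::real})"
      by simp
    then have "((\<lambda>t. 0) has_vector_derivative (w \<bullet> (v - x))) (at 0 within {0..1})"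
      by (simp add: has_vector_derivative_def)
    moreover have "((\<lambda>t. 0) has_vector_derivative (0::real)) (at 0 within {0..1})"
      by simp
    moreover have "at (0::real) within {0..1} \<noteq> bot"
      by (simp add: at_within_Icc_at_right)
    ultimately show ?thesis
      by (rule vector_derivative_unique_within[rotated])
  qed
  have "w = 0"
  proof (rule ccontr)
    assume "w \<noteq> 0"
    have "w \<bullet> (a - x) = 0" "w \<bullet> (a + (r / norm w) *\<^sub>R w - x) = 0"
      using r \<open>w \<noteq> 0\<close> by (auto intro!: orth simp: dist_norm)
    then have "(r / norm w) * (w \<bullet> w) = 0"
      by (simp add: inner_diff_right inner_add_right)
    then show False
      using r \<open>w \<noteq> 0\<close> by simp
  qed
  then show "g' = g"
    by (simp add: w_def)
qed

definition C1_on :: "'a::euclidean_space set \<Rightarrow> ('a \<Rightarrow> real) \<Rightarrow> bool" where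
  "C1_on D f \<longleftrightarrow> f differentiable_on D \<and> continuous_on D (gradient_within D f)"

section \<open>Zero sets and the condition number\<close>

definition zero_set :: "'a::euclidean_space set \<Rightarrow> ('a \<Rightarrow> real) \<Rightarrow> 'a set" where
  "zero_set D f = {x \<in> D. f x = 0}"

definition regular_zero_set :: "'a::euclidean_space set \<Rightarrow> ('a \<Rightarrow> real) \<Rightarrow> bool" where
  "regular_zero_set D f \<longleftrightarrow> (\<forall>x \<in> zero_set D f. gradient_within D f x \<noteq> 0)"

definition nu1 :: "('a::euclidean_space \<Rightarrow> real) \<Rightarrow> 'a set \<Rightarrow> real" where
  "nu1 f D = (SUP x \<in> D. sqrt (\<bar>f x\<bar>\<^sup>2 + (norm (gradient_within D f x))\<^sup>2))"

definition delta :: "('a::euclidean_space \<Rightarrow> real) \<Rightarrow> 'a set \<Rightarrow> real" where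
  "delta f D = (INF x \<in> D. sqrt (\<bar>f x\<bar>\<^sup>2 + (norm (gradient_within D f x))\<^sup>2))"

text \<open>For continuous \<open>f\<close> and compact nonempty \<open>frontier D\<close> this infimum is attained.\<close>

definition boundary_min :: "('a::euclidean_space \<Rightarrow> real) \<Rightarrow> 'a set \<Rightarrow> real" where
  "boundary_min f D = (INF x \<in> frontier D. \<bar>f x\<bar>)"

definition kappa1 :: "('a::euclidean_space \<Rightarrow> real) \<Rightarrow> 'a set \<Rightarrow> real" where
  "kappa1 f D = nu1 f D / min (boundary_min f D) (delta f D)"

end

theory Submission
  imports Defs
begin

text \<open>Let \<open>t\<close> be half of \<open>min {m(f,D), \<delta>(f,D)}\<close>. On the sublevel set
  \<open>W = {x \<in> D. \<bar>f(x)\<bar> \<le> t}\<close> the gradient does not vanish and \<open>W\<close> stays away from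
  the boundary, so descending along the gradient of \<open>f\<^sup>2/2\<close> retracts \<open>W\<close> onto \<open>Z(f)\<close>.
  As \<open>f\<close> is Lipschitz with constant \<open>\<nu>\<^sub>1(f,D)\<close>, balls of radius \<open>s = 1/(2\<kappa>\<^sub>1)\<close> around
  points of \<open>Z(f)\<close> lie in \<open>W\<close>. The union \<open>U\<close> of such balls around a maximal
  \<open>s\<close>-separated subset of \<open>Z(f)\<close> satisfies \<open>Z(f) \<subseteq> U \<subseteq> W\<close>; hence \<open>Z(f)\<close> is a retract
  of \<open>U\<close> and \<open>b(Z(f)) \<le> b(U)\<close>. By volume comparison there are \<open>O(\<kappa>\<^sub>1\<^sup>n)\<close> balls, each
  meeting at most \<open>5\<^sup>n\<close> of them, and adding the balls one at a time the
  Mayer--Vietoris inequality \<open>b(A \<union> B) \<le> b(A) + b(B) + b(A \<inter> B)\<close> bounds \<open>b(U)\<close> by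
  \<open>2^(5^n)\<close> times their number.\<close>

section \<open>Ranks of abelian groups\<close>

text \<open>Indexing the elements lets images and lifts of group elements be treated before they are
  known to be distinct.\<close>

definition independent_family :: "('a, 'b) monoid_scheme \<Rightarrow> 'i set \<Rightarrow> ('i \<Rightarrow> 'a) \<Rightarrow> bool" where
  "independent_family G I x \<longleftrightarrow>
     finite I \<and> x \<in> I \<rightarrow> carrier G \<and>
     (\<forall>c :: 'i \<Rightarrow> int. finprod G (\<lambda>i. x i [^]\<^bsub>G\<^esub> c i) I = \<one>\<^bsub>G\<^esub> \<longrightarrow> (\<forall>i\<in>I. c i = 0))"

lemma int_independentD:
  fixes c :: "'a \<Rightarrow> int"
  assumes "int_independent G S" "finprod G (\<lambda>x. x [^]\<^bsub>G\<^esub> c x) S = \<one>\<^bsub>G\<^esub>" "x \<in> S"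
  shows "c x = 0"
  using assms by (simp add: int_independent_def)

context comm_group
begin

text \<open>If two indices shared a value, the coefficients 1 and -1 at them would give a nontrivial
  relation.\<close>

lemma independent_family_inj:
  assumes "independent_family G I x"
  shows "inj_on x I"
proof (rule inj_onI, rule ccontr)
  fix i j assume ij: "i \<in> I" "j \<in> I" "x i = x j" "i \<noteq> j"
  have fin: "finite I" and car: "\<And>i. i \<in> I \<Longrightarrow> x i \<in> carrier G"
    using assms by (auto simp: independent_family_def)
  define c :: "_ \<Rightarrow> int" where "c k = (if k = i then 1 else if k = j then -1 else 0)" for k
  have I: "I = insert i (insert j (I - {i, j}))"
    using ij by auto
  have one: "finprod G (\<lambda>k. x k [^] c k) (I - {i, j}) = \<one>"
    by (rule finprod_one_eqI) (auto simp: c_def)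
  have "finprod G (\<lambda>k. x k [^] c k) (insert i (insert j (I - {i, j}))) = x i [^] (1::int) \<otimes> (x j [^] (-1::int) \<otimes> \<one>)"
    using fin ij car one by (subst finprod_insert; (auto simp: c_def)?)
  also have "\<dots> = \<one>"
    using ij car by (simp add: int_pow_neg)
  finally have "finprod G (\<lambda>k. x k [^] c k) I = \<one>"
    using I by simp
  then have "c i = 0"
    using assms ij by (auto simp: independent_family_def)
  then show False
    by (simp add: c_def)
qed

lemma independent_family_image:
  assumes "independent_family G I x"
  shows "int_independent G (x ` I)"
proof -
  have inj: "inj_on x I"
    by (rule independent_family_inj[OF assms])
  have car: "finite I" "x i \<in> carrier G" if "i \<in> I" for i
    using assms that by (auto simp: independent_family_def)
  have zero: "\<forall>i\<in>I. c i = 0" if "finprod G (\<lambda>i. x i [^] c i) I = \<one>" for c :: "_ \<Rightarrow> int"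
    using assms that by (simp add: independent_family_def)
  have eq: "finprod G (\<lambda>y. y [^] c y) (x ` I) = finprod G (\<lambda>i. x i [^] c (x i)) I" for c :: "_ \<Rightarrow> int"
    using inj car by (intro finprod_reindex) auto
  show ?thesis
    unfolding int_independent_def eq
  proof (intro conjI allI impI)
    show "finite (x ` I)" "x ` I \<subseteq> carrier G"
      using assms by (auto simp: independent_family_def)
    show "\<forall>y\<in>x ` I. c y = 0" if "finprod G (\<lambda>i. x i [^] c (x i)) I = \<one>" for c :: "_ \<Rightarrow> int"
      using zero[OF that] by simp
  qed
qed

lemma card_le_abelian_rank:
  assumes "independent_family G I x"
  shows "enat (card I) \<le> abelian_rank G"
proof -
  have "enat (card (x ` I)) \<le> abelian_rank G"
    unfolding abelian_rank_def using independent_family_image[OF assms] by (intro SUP_upper) auto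
  then show ?thesis
    using independent_family_inj[OF assms] by (simp add: card_image)
qed

lemma int_pow_finprod:
  fixes k :: int
  assumes "finite S" "x \<in> S \<rightarrow> carrier G"
  shows "finprod G x S [^] k = finprod G (\<lambda>i. x i [^] k) S"
  using assms by (induction S) (auto simp: int_pow_distrib Pi_iff)

text \<open>This is the interchange of a double sum, written multiplicatively. It turns a relation
  among combinations of the \<open>x i\<close> into a relation among the \<open>x i\<close>
  themselves.\<close>

lemma finprod_int_pow_combination:
  fixes c :: "'j \<Rightarrow> 'i \<Rightarrow> int"
  assumes "finite J" "finite S" "x \<in> S \<rightarrow> carrier G"
  shows "finprod G (\<lambda>j. finprod G (\<lambda>i. x i [^] c j i) S [^] d j) J
    = finprod G (\<lambda>i. x i [^] (\<Sum>j\<in>J. c j i * d j)) S"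
  using assms(1)
proof (induction J)
  case empty
  then show ?case by (simp add: finprod_one_eqI)
next
  case (insert j J)
  have x: "x i \<in> carrier G" if "i \<in> S" for i
    using assms that by auto
  have "finprod G (\<lambda>i. x i [^] (\<Sum>j\<in>insert j J. c j i * d j)) S
    = finprod G (\<lambda>i. (x i [^] c j i) [^] d j \<otimes> x i [^] (\<Sum>j\<in>J. c j i * d j)) S"
    using insert x by (intro finprod_cong') (auto simp: int_pow_mult int_pow_pow mult.commute)
  also have "\<dots> = finprod G (\<lambda>i. x i [^] c j i) S [^] d j \<otimes> finprod G (\<lambda>i. x i [^] (\<Sum>j\<in>J. c j i * d j)) S"
    using x by (subst int_pow_finprod) (auto simp: assms(2) intro!: finprod_multf)
  finally show ?case
    using insert x by (subst finprod_insert) (auto intro!: finprod_closed int_pow_closed)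
qed

end

lemma (in group_hom) hom_finprod_int_pow:
  fixes c :: "'i \<Rightarrow> int"
  assumes "comm_group G" "comm_group H" "finite S" "x \<in> S \<rightarrow> carrier G"
  shows "h (finprod G (\<lambda>i. x i [^]\<^bsub>G\<^esub> c i) S) = finprod H (\<lambda>i. h (x i) [^]\<^bsub>H\<^esub> c i) S"
  using assms(3,4)
proof (induction S)
  case empty
  then show ?case by (simp add: assms(1,2) comm_group.axioms comm_monoid.finprod_empty)
next
  case (insert s S)
  interpret G: comm_group G by (rule assms)
  interpret H: comm_group H by (rule assms)
  from insert show ?case
    by (simp add: Pi_iff hom_int_pow)
qed

text \<open>Split an independent set \<open>S\<close> of \<open>B\<close> along a maximal subset \<open>T\<close> whose image in \<open>C\<close>
  is independent: by maximality each \<open>s \<in> S - T\<close> has a nonzero multiple that is a combination of \<open>T\<close>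
  modulo the kernel of \<open>g\<close>, and the resulting kernel elements lift to an independent family of \<open>A\<close>.\<close>

lemma abelian_rank_exact:
  fixes A :: "('a, 'd) monoid_scheme" and B :: "('b, 'e) monoid_scheme" and C :: "('c, 'f) monoid_scheme"
  assumes A: "comm_group A" and B: "comm_group B" and C: "comm_group C"
    and f: "f \<in> hom A B" and g: "g \<in> hom B C"
    and exact: "kernel B C g \<subseteq> f ` carrier A"
  shows "abelian_rank B \<le> abelian_rank A + abelian_rank C"
  unfolding abelian_rank_def[of B]
proof (rule SUP_least)
  fix S assume "S \<in> {S. int_independent B S}"
  then have S: "int_independent B S" by simp
  interpret A: comm_group A by (rule A)
  interpret B: comm_group B by (rule B)
  interpret C: comm_group C by (rule C)
  interpret f: group_hom A B f using f by unfold_locales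
  interpret g: group_hom B C g using g by unfold_locales
  have finS: "finite S" and carS: "\<And>s. s \<in> S \<Longrightarrow> s \<in> carrier B"
    using S by (auto simp: int_independent_def)
  have "{T. T \<subseteq> S \<and> independent_family C T g} \<noteq> {}"
    by (auto simp: independent_family_def intro!: exI[of _ "{}"])
  moreover have "finite {T. T \<subseteq> S \<and> independent_family C T g}"
    using finS by simp
  ultimately obtain T where T: "T \<subseteq> S" "independent_family C T g"
    and Tmax: "\<And>T'. T' \<subseteq> S \<Longrightarrow> independent_family C T' g \<Longrightarrow> T \<subseteq> T' \<Longrightarrow> T = T'"
    using finite_has_maximal[of "{T. T \<subseteq> S \<and> independent_family C T g}"] by auto
  have finT: "finite T" using T finS finite_subset by blast
  have "\<exists>c :: 'b \<Rightarrow> int. c s \<noteq> 0 \<and> (\<forall>t\<in>S - T. t \<noteq> s \<longrightarrow> c t = 0) \<and>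
      (\<exists>a\<in>carrier A. f a = finprod B (\<lambda>t. t [^]\<^bsub>B\<^esub> c t) S)" if s: "s \<in> S - T" for s
  proof -
    have "\<not> independent_family C (insert s T) g"
      using Tmax[of "insert s T"] T s by auto
    moreover have "finite (insert s T)" "g \<in> insert s T \<rightarrow> carrier C"
      using finT s T carS by auto
    ultimately obtain c :: "'b \<Rightarrow> int" where
      c: "finprod C (\<lambda>i. g i [^]\<^bsub>C\<^esub> c i) (insert s T) = \<one>\<^bsub>C\<^esub>" and nz: "\<not> (\<forall>i\<in>insert s T. c i = 0)"
      unfolding independent_family_def by blast
    have gT: "g t \<in> carrier C" if "t \<in> S" for t
      using carS that by auto
    have eq: "finprod C (\<lambda>i. g i [^]\<^bsub>C\<^esub> c i) (insert s T)
        = g s [^]\<^bsub>C\<^esub> c s \<otimes>\<^bsub>C\<^esub> finprod C (\<lambda>i. g i [^]\<^bsub>C\<^esub> c i) T"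
      using finT s T gT by (intro C.finprod_insert) auto
    \<comment> \<open>With coefficient zero at \<open>s\<close> there would remain a nontrivial
      relation on \<open>T\<close> alone.\<close>
    have cs: "c s \<noteq> 0"
    proof
      assume z: "c s = 0"
      have "finprod C (\<lambda>i. g i [^]\<^bsub>C\<^esub> c i) T \<in> carrier C"
        using T gT by (intro C.finprod_closed) auto
      then have "finprod C (\<lambda>i. g i [^]\<^bsub>C\<^esub> c i) T = \<one>\<^bsub>C\<^esub>"
        using eq c z by simp
      then show False
        using T nz z by (auto simp: independent_family_def)
    qed
    \<comment> \<open>Extending by zero leaves \<open>s\<close> as the only element of
      \<open>S - T\<close> with a nonzero coefficient.\<close>
    define c' where "c' t = (if t \<in> insert s T then c t else 0)" for t
    have "g (finprod B (\<lambda>t. t [^]\<^bsub>B\<^esub> c' t) S) = finprod C (\<lambda>t. g t [^]\<^bsub>C\<^esub> c' t) S"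
      by (rule g.hom_finprod_int_pow[OF B C finS, of "\<lambda>x. x"]) (use carS in auto)
    also have "\<dots> = finprod C (\<lambda>t. g t [^]\<^bsub>C\<^esub> c t) (insert s T)"
      using finS s T gT by (intro C.finprod_mono_neutral_cong_right) (auto simp: c'_def)
    finally have "finprod B (\<lambda>t. t [^]\<^bsub>B\<^esub> c' t) S \<in> kernel B C g"
      using c carS by (auto simp: kernel_def)
    then have "\<exists>a\<in>carrier A. f a = finprod B (\<lambda>t. t [^]\<^bsub>B\<^esub> c' t) S"
      using exact by (metis imageE subsetD)
    then show ?thesis
      using cs by (intro exI[of _ c']) (auto simp: c'_def)
  qed
  then have "\<forall>s\<in>S - T. \<exists>c :: 'b \<Rightarrow> int. c s \<noteq> 0 \<and> (\<forall>t\<in>S - T. t \<noteq> s \<longrightarrow> c t = 0) \<and>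
      (\<exists>a\<in>carrier A. f a = finprod B (\<lambda>t. t [^]\<^bsub>B\<^esub> c t) S)"
    by blast
  from bchoice[OF this] obtain c :: "'b \<Rightarrow> 'b \<Rightarrow> int" where
    c: "\<forall>s\<in>S - T. c s s \<noteq> 0 \<and> (\<forall>t\<in>S - T. t \<noteq> s \<longrightarrow> c s t = 0) \<and>
      (\<exists>a\<in>carrier A. f a = finprod B (\<lambda>t. t [^]\<^bsub>B\<^esub> c s t) S)"
    by blast
  then have "\<forall>s\<in>S - T. \<exists>a. a \<in> carrier A \<and> f a = finprod B (\<lambda>t. t [^]\<^bsub>B\<^esub> c s t) S"
    by blast
  from bchoice[OF this] obtain a where
    a: "\<forall>s\<in>S - T. a s \<in> carrier A \<and> f (a s) = finprod B (\<lambda>t. t [^]\<^bsub>B\<^esub> c s t) S"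
    by blast
  have "independent_family A (S - T) a"
    unfolding independent_family_def
  proof (intro conjI allI impI)
    show "finite (S - T)" "a \<in> S - T \<rightarrow> carrier A"
      using finS a by auto
    fix d :: "'b \<Rightarrow> int"
    assume d: "finprod A (\<lambda>s. a s [^]\<^bsub>A\<^esub> d s) (S - T) = \<one>\<^bsub>A\<^esub>"
    have "f (finprod A (\<lambda>s. a s [^]\<^bsub>A\<^esub> d s) (S - T)) = finprod B (\<lambda>s. f (a s) [^]\<^bsub>B\<^esub> d s) (S - T)"
      by (rule f.hom_finprod_int_pow[OF A B]) (use finS a in auto)
    also have "\<dots> = finprod B (\<lambda>s. finprod B (\<lambda>t. t [^]\<^bsub>B\<^esub> c s t) S [^]\<^bsub>B\<^esub> d s) (S - T)"
      using a carS by (intro B.finprod_cong') auto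
    also have "\<dots> = finprod B (\<lambda>t. t [^]\<^bsub>B\<^esub> (\<Sum>s\<in>S - T. c s t * d s)) S"
      using finS carS by (intro B.finprod_int_pow_combination) auto
    finally have "finprod B (\<lambda>t. t [^]\<^bsub>B\<^esub> (\<Sum>s\<in>S - T. c s t * d s)) S = \<one>\<^bsub>B\<^esub>"
      using d by simp
    note z = int_independentD[OF S this]
    show "\<forall>s\<in>S - T. d s = 0"
    proof
      fix t assume t: "t \<in> S - T"
      \<comment> \<open>Restricted to \<open>S - T\<close>, the coefficient matrix is diagonal with
        nonzero diagonal entries.\<close>
      have "(\<Sum>s\<in>S - T. c s t * d s) = (\<Sum>s\<in>S - T. if s = t then c t t * d t else 0)"
        using c t by (intro sum.cong) auto
      also have "\<dots> = c t t * d t"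
        using finS t by simp
      finally show "d t = 0"
        using z[of t] c t by auto
    qed
  qed
  then have "enat (card (S - T)) \<le> abelian_rank A"
    by (rule A.card_le_abelian_rank)
  moreover have "enat (card T) \<le> abelian_rank C"
    using T by (intro C.card_le_abelian_rank)
  moreover have "enat (card S) = enat (card (S - T)) + enat (card T)"
    using T finT card_mono[OF finS T(1)] by (simp add: card_Diff_subset)
  ultimately show "enat (card S) \<le> abelian_rank A + abelian_rank C"
    by (simp add: add_mono del: plus_enat_simps)
qed

lemma abelian_rank_trivial:
  assumes "trivial_group G"
  shows "abelian_rank G = 0"
proof -
  have "S = {}" if S: "int_independent G S" for S
  proof (rule ccontr)
    assume "S \<noteq> {}"
    have one: "carrier G = {\<one>\<^bsub>G\<^esub>}" and "group G"
      using assms by (auto simp: trivial_group_def)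
    then interpret comm_group G
      by (intro group.group_comm_groupI) (auto simp: group.is_monoid)
    have "finprod G (\<lambda>x. x [^]\<^bsub>G\<^esub> (1::int)) S = \<one>\<^bsub>G\<^esub>"
      using S one by (intro finprod_one_eqI) (auto simp: int_independent_def)
    from int_independentD[OF S this] show False
      using \<open>S \<noteq> {}\<close> by auto
  qed
  then have "abelian_rank G \<le> 0"
    unfolding abelian_rank_def by (intro SUP_least) (force simp: zero_enat_def)
  then show ?thesis by simp
qed

text \<open>Injectivity is exactness at \<open>A\<close> with a trivial group on the left, so the
  rank inequality for exact sequences applies with a zero term.\<close>

lemma abelian_rank_mono:
  assumes "comm_group A" "comm_group B" "f \<in> hom A B" "inj_on f (carrier A)"
  shows "abelian_rank A \<le> abelian_rank B"
proof -
  interpret A: comm_group A by fact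
  interpret B: comm_group B by fact
  interpret f: group_hom A B f using assms by unfold_locales
  let ?U = "singleton_group undefined :: unit monoid"
  have "comm_group ?U"
    by simp
  moreover have "kernel A B f \<subseteq> (\<lambda>_. \<one>\<^bsub>A\<^esub>) ` carrier ?U"
    using assms(4) f.inj_iff_trivial_ker by (auto simp: singleton_group_def)
  ultimately have "abelian_rank A \<le> abelian_rank ?U + abelian_rank B"
    using assms by (intro abelian_rank_exact[where f = "\<lambda>_. \<one>\<^bsub>A\<^esub>"]) (auto simp: trivial_hom)
  moreover have "abelian_rank ?U = 0"
    by (rule abelian_rank_trivial) simp
  ultimately show ?thesis
    by simp
qed

lemma abelian_rank_integer_group: "abelian_rank integer_group \<le> 1"
  unfolding abelian_rank_def
proof (rule SUP_least)
  fix S assume "S \<in> {S. int_independent integer_group S}"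
  then have S: "int_independent integer_group S" by simp
  interpret comm_group integer_group by (rule abelian_integer_group)
  have fin: "finite S" using S by (simp add: int_independent_def)
  have "\<not> 1 < card S"
  proof
    assume "1 < card S"
    then obtain a b where ab: "a \<in> S" "b \<in> S" "a \<noteq> b"
      by (metis card_1_singletonE card_le_Suc0_iff_eq fin not_less One_nat_def)
    \<comment> \<open>The relation is b * a - a * b = 0; if both coefficients vanished,
      \<open>a\<close> and \<open>b\<close> would both be 0.\<close>
    define c :: "int \<Rightarrow> int" where "c k = (if k = a then b else if k = b then - a else 0)" for k
    have "finprod integer_group (\<lambda>x. x [^]\<^bsub>integer_group\<^esub> c x) S
        = finprod integer_group (\<lambda>x. x [^]\<^bsub>integer_group\<^esub> c x) {a, b}"
      using ab fin by (intro finprod_mono_neutral_cong_right) (auto simp: c_def)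
    also have "\<dots> = \<one>\<^bsub>integer_group\<^esub>"
      using ab by (simp add: c_def Pi_iff)
    finally have "c a = 0" "c b = 0"
      using S ab by (auto simp: int_independent_def)
    then show False
      using ab by (auto simp: c_def split: if_splits)
  qed
  then show "enat (card S) \<le> 1"
    by (simp add: one_enat_def)
qed

section \<open>Betti numbers of unions of convex open sets\<close>

text \<open>Exactness of the long sequence of the pair at its absolute term.\<close>

lemma abelian_rank_homology_pair:
  "abelian_rank (homology_group p X)
    \<le> abelian_rank (homology_group p (subtopology X S)) + abelian_rank (relative_homology_group p X S)"
proof (rule abelian_rank_exact[where g = "hom_induced p X {} X S id"])
  show "kernel (homology_group p X) (relative_homology_group p X S) (hom_induced p X {} X S id)
      \<subseteq> hom_induced p (subtopology X S) {} X {} id ` carrier (homology_group p (subtopology X S))"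
    using homology_exactness_axiom_3[of p X S] by simp
qed (auto simp: hom_induced_hom)

text \<open>Exactness of the same sequence at its relative term.\<close>

lemma abelian_rank_relative_homology:
  "abelian_rank (relative_homology_group p X S)
    \<le> abelian_rank (homology_group p X) + abelian_rank (homology_group (p - 1) (subtopology X S))"
proof (rule abelian_rank_exact[where g = "hom_boundary p X S"])
  show "kernel (relative_homology_group p X S) (homology_group (p - 1) (subtopology X S)) (hom_boundary p X S)
      \<subseteq> hom_induced p X {} X S id ` carrier (homology_group p X)"
    using homology_exactness_axiom_1[of p X S] by simp
qed (auto simp: hom_induced_hom hom_boundary_hom)

lemma abelian_rank_iso:
  assumes "comm_group G" "comm_group H" "f \<in> iso G H"
  shows "abelian_rank G = abelian_rank H"
proof (rule antisym)
  have f: "f \<in> hom G H" "bij_betw f (carrier G) (carrier H)"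
    using assms(3) by (auto simp: iso_def)
  show "abelian_rank G \<le> abelian_rank H"
    using f assms by (intro abelian_rank_mono[of _ _ f]) (auto simp: bij_betw_def)
  have "inv_into (carrier G) f \<in> iso H G"
    using assms comm_group.axioms(2) group.iso_set_sym by blast
  then show "abelian_rank H \<le> abelian_rank G"
    using assms by (intro abelian_rank_mono[of _ _ "inv_into (carrier G) f"]) (auto simp: iso_def bij_betw_def)
qed

text \<open>Excise \<open>B - A\<close>. It is closed in \<open>A \<union> B\<close> and contained
  in the open set \<open>B\<close>, so the closure-interior condition of the excision axiom
  holds.\<close>

lemma abelian_rank_relative_homology_excision:
  assumes "open A" "open B"
  shows "abelian_rank (relative_homology_group p (top_of_set (A \<union> B)) B)
    = abelian_rank (relative_homology_group p (top_of_set A) (A \<inter> B))"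
proof -
  let ?X = "top_of_set (A \<union> B)"
  have "closedin ?X (A \<union> B - A)"
    using assms by (intro closedin_diff open_subset) auto
  moreover have "A \<union> B - A = B - A"
    by auto
  ultimately have "?X closure_of (B - A) = B - A"
    by (simp add: closure_of_closedin)
  moreover have "?X interior_of B = B"
    using assms by (intro interior_of_openin open_subset) auto
  ultimately have "hom_induced p (subtopology ?X (A \<union> B - (B - A))) (B - (B - A)) (subtopology ?X (A \<union> B)) B id
    \<in> iso (relative_homology_group p (subtopology ?X (A \<union> B - (B - A))) (B - (B - A)))
          (relative_homology_group p (subtopology ?X (A \<union> B)) B)"
    by (intro homology_excision_axiom) auto
  moreover have "A \<union> B - (B - A) = A" "B - (B - A) = A \<inter> B" "(A \<union> B) \<inter> A = A"
    by auto
  ultimately show ?thesis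
    by (intro abelian_rank_iso[symmetric]) (auto simp: subtopology_subtopology)
qed

text \<open>The Mayer-Vietoris inequality follows without the sequence itself: pass from
  \<open>A \<union> B\<close> to the pair with \<open>B\<close>, excise, and pass to the pair of
  \<open>A\<close> with \<open>A \<inter> B\<close>.\<close>

lemma betti_number_open_Un:
  assumes "open A" "open B"
  shows "betti_number p (top_of_set (A \<union> B)) \<le> betti_number p (top_of_set A) + betti_number p (top_of_set B)
    + (case p of 0 \<Rightarrow> 0 | Suc q \<Rightarrow> betti_number q (top_of_set (A \<inter> B)))"
proof -
  have sub: "subtopology (top_of_set (A \<union> B)) B = top_of_set B"
    "subtopology (top_of_set A) (A \<inter> B) = top_of_set (A \<inter> B)"
    by (simp_all add: subtopology_subtopology Int_absorb1)
  have "betti_number p (top_of_set (A \<union> B))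
      \<le> betti_number p (top_of_set B) + abelian_rank (relative_homology_group p (top_of_set (A \<union> B)) B)"
    using abelian_rank_homology_pair[of p "top_of_set (A \<union> B)" B] by (simp add: betti_number_def sub)
  also have "\<dots> = betti_number p (top_of_set B) + abelian_rank (relative_homology_group p (top_of_set A) (A \<inter> B))"
    by (simp add: abelian_rank_relative_homology_excision assms)
  also have "\<dots> \<le> betti_number p (top_of_set B) + (betti_number p (top_of_set A)
      + abelian_rank (homology_group (int p - 1) (top_of_set (A \<inter> B))))"
    using abelian_rank_relative_homology[of p "top_of_set A" "A \<inter> B"]
    by (intro add_left_mono) (simp add: betti_number_def sub)
  \<comment> \<open>For \<open>p = 0\<close> the group lies in degree -1 and is trivial.\<close>
  also have "abelian_rank (homology_group (int p - 1) (top_of_set (A \<inter> B)))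
    = (case p of 0 \<Rightarrow> 0 | Suc q \<Rightarrow> betti_number q (top_of_set (A \<inter> B)))"
    by (auto simp: betti_number_def abelian_rank_trivial split: nat.split)
  finally show ?thesis
    by (simp add: ac_simps)
qed

lemma sum_betti_number_le: "(\<Sum>p<N. betti_number p (top_of_set S)) \<le> betti_sum S"
  unfolding betti_sum_def by (intro sum_le_suminf summableI) auto

lemma betti_sum_open_Un:
  assumes "open A" "open B"
  shows "betti_sum (A \<union> B) \<le> betti_sum A + betti_sum B + betti_sum (A \<inter> B)"
  unfolding betti_sum_def[of "A \<union> B"] suminf_eq_SUP
proof (rule SUP_least)
  fix N :: nat
  have le: "(\<Sum>p<N. betti_number p (top_of_set (A \<union> B))) \<le>
     (\<Sum>p<N. betti_number p (top_of_set A)) + (\<Sum>p<N. betti_number p (top_of_set B))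
      + (\<Sum>p<N. case p of 0 \<Rightarrow> 0 | Suc q \<Rightarrow> betti_number q (top_of_set (A \<inter> B)))"
    unfolding sum.distrib[symmetric] by (intro sum_mono betti_number_open_Un assms)
  \<comment> \<open>Because of the degree shift, \<open>N\<close> terms here are only the first N -
    1 Betti numbers of the intersection.\<close>
  have "(\<Sum>p<N. case p of 0 \<Rightarrow> 0 | Suc q \<Rightarrow> betti_number q (top_of_set (A \<inter> B))) \<le> betti_sum (A \<inter> B)"
  proof (cases N)
    case (Suc M)
    then show ?thesis
      using sum_betti_number_le[where N = M and S = "A \<inter> B"] by (simp add: sum.lessThan_Suc_shift del: sum.lessThan_Suc)
  qed simp
  then show "(\<Sum>p<N. betti_number p (top_of_set (A \<union> B))) \<le> betti_sum A + betti_sum B + betti_sum (A \<inter> B)"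
    by (intro order_trans[OF le] add_mono sum_betti_number_le)
qed

section \<open>Total Betti numbers of convex sets, retracts and finite unions\<close>

lemma betti_sum_empty: "betti_sum {} = 0"
  by (simp add: betti_sum_def betti_number_def abelian_rank_trivial trivial_homology_group_empty)

text \<open>A nonempty convex set is homotopy equivalent to a point, whose homology is the integers
  in degree 0 and trivial elsewhere.\<close>

lemma betti_sum_convex:
  fixes C :: "'a::real_normed_vector set"
  assumes "convex C"
  shows "betti_sum C \<le> 1"
proof (cases "C = {}")
  case False
  have "contractible_space (top_of_set C)"
    using convex_imp_contractible[OF assms] by (simp add: contractible_space_def contractible_def)
  then obtain a where a: "a \<in> C" "top_of_set C homotopy_equivalent_space subtopology (top_of_set C) {a}"
    using False by (auto simp: contractible_eq_homotopy_equivalent_singleton_subtopology null_topspace_iff_trivial[symmetric] simp del: null_topspace_iff_trivial)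
  have eq: "betti_number p (top_of_set C) = betti_number p (top_of_set {a})" for p
    using homotopy_equivalent_space_imp_isomorphic_homology_groups[OF a(2), of p] a(1)
    unfolding betti_number_def is_iso_def
    by (auto simp: subtopology_subtopology intro!: abelian_rank_iso)
  have "betti_number 0 (top_of_set {a}) \<le> 1"
    using homology_coefficients[of "top_of_set {a}" a] abelian_rank_integer_group
    by (auto simp: betti_number_def is_iso_def intro: abelian_integer_group dest!: abelian_rank_iso[rotated 2])
  moreover have "betti_number p (top_of_set {a}) = 0" if "p \<noteq> 0" for p
    using that by (simp add: betti_number_def abelian_rank_trivial homology_dimension_axiom)
  ultimately show ?thesis
    unfolding betti_sum_def eq by (subst suminf_finite[of "{0}"]) auto
qed (simp add: betti_sum_empty)

text \<open>A retraction induces a left inverse on homology, so the inclusion of \<open>Z\<close> is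
  injective in every degree.\<close>

lemma betti_sum_retract:
  assumes "Z retract_of U"
  shows "betti_sum Z \<le> betti_sum U"
  unfolding betti_sum_def
proof (intro suminf_le summableI)
  fix p
  obtain r where r: "retraction U Z r"
    using assms by (auto simp: retract_of_def)
  have Z: "Z \<subseteq> U" "subtopology (top_of_set U) Z = top_of_set Z"
    using r by (auto simp: retraction_def subtopology_subtopology Int_absorb1)
  have "Z retract_of_space top_of_set U"
    using r Z by (auto simp: retract_of_space_def retraction_def image_subset_iff_funcset)
  then have "inj_on (hom_induced (int p) (top_of_set Z) {} (top_of_set U) {} id) (carrier (homology_group p (top_of_set Z)))"
    using inj_on_hom_induced_inclusion[of Z "top_of_set U" p] by (simp add: Z)
  then show "betti_number p (top_of_set Z) \<le> betti_number p (top_of_set U)"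
    unfolding betti_number_def by (intro abelian_rank_mono) (auto simp: hom_induced_hom)
qed

text \<open>The added 1 makes the bound exactly double with each new set. The family is kept
  arbitrary because the induction hypothesis is also applied to the sets
  \<open>C j \<inter> C i\<close>.\<close>

lemma betti_sum_Union_convex:
  fixes C :: "'i \<Rightarrow> 'a::real_normed_vector set"
  assumes "finite I" "\<And>i. i \<in> I \<Longrightarrow> open (C i)" "\<And>i. i \<in> I \<Longrightarrow> convex (C i)"
  shows "betti_sum (\<Union>i\<in>I. C i) + 1 \<le> 2 ^ card I"
  using assms
proof (induction I arbitrary: C)
  case empty
  then show ?case by (simp add: betti_sum_empty)
next
  case (insert j I)
  have eq: "C j \<inter> (\<Union>i\<in>I. C i) = (\<Union>i\<in>I. C j \<inter> C i)"
    by auto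
  have "betti_sum (C j \<union> (\<Union>i\<in>I. C i)) \<le> betti_sum (C j) + betti_sum (\<Union>i\<in>I. C i) + betti_sum (\<Union>i\<in>I. C j \<inter> C i)"
    using betti_sum_open_Un[of "C j" "\<Union>i\<in>I. C i"] insert.prems unfolding eq by auto
  also have "\<dots> \<le> 1 + betti_sum (\<Union>i\<in>I. C i) + betti_sum (\<Union>i\<in>I. C j \<inter> C i)"
    using insert.prems by (intro add_mono betti_sum_convex) auto
  finally have "betti_sum (\<Union>i\<in>insert j I. C i) + 1
      \<le> (betti_sum (\<Union>i\<in>I. C i) + 1) + (betti_sum (\<Union>i\<in>I. C j \<inter> C i) + 1)"
    by (simp add: ac_simps add_left_mono)
  also have "\<dots> \<le> 2 ^ card I + 2 ^ card I"
    using insert.prems by (intro add_mono insert.IH) (auto intro: convex_Int)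
  finally show ?case
    using insert.hyps by (simp flip: mult_2)
qed

text \<open>Each new set costs at most \<open>2 ^ M\<close>, since it meets the earlier union in a
  union of at most \<open>M\<close> convex sets. The bound is thus linear in the number of
  sets.\<close>

lemma betti_sum_Union_convex_bounded_overlap:
  fixes C :: "'i \<Rightarrow> 'a::real_normed_vector set"
  assumes "finite I" "\<And>i. i \<in> I \<Longrightarrow> open (C i)" "\<And>i. i \<in> I \<Longrightarrow> convex (C i)"
    and "\<And>j. j \<in> I \<Longrightarrow> card {i \<in> I. C i \<inter> C j \<noteq> {}} \<le> M"
  shows "betti_sum (\<Union>i\<in>I. C i) \<le> of_nat (card I * 2 ^ M)"
  using assms
proof (induction I)
  case empty
  then show ?case by (simp add: betti_sum_empty)
next
  case (insert j I)
  define K where "K = {i \<in> I. C i \<inter> C j \<noteq> {}}"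
  have eq: "C j \<inter> (\<Union>i\<in>I. C i) = (\<Union>i\<in>K. C j \<inter> C i)"
    by (auto simp: K_def)
  have "card {i \<in> I. C i \<inter> C k \<noteq> {}} \<le> M" if "k \<in> insert j I" for k
    using that insert.hyps by (intro order_trans[OF card_mono insert.prems(3)]) auto
  then have IH: "betti_sum (\<Union>i\<in>I. C i) \<le> of_nat (card I * 2 ^ M)" and K: "card K \<le> M"
    using insert.prems insert.IH by (auto simp: K_def)
  have "betti_sum (C j \<union> (\<Union>i\<in>I. C i)) \<le> betti_sum (C j) + betti_sum (\<Union>i\<in>I. C i) + betti_sum (\<Union>i\<in>K. C j \<inter> C i)"
    using betti_sum_open_Un[of "C j" "\<Union>i\<in>I. C i"] insert.prems unfolding eq by auto
  also have "\<dots> \<le> 1 + of_nat (card I * 2 ^ M) + betti_sum (\<Union>i\<in>K. C j \<inter> C i)"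
    using insert.prems by (intro add_mono betti_sum_convex IH) auto
  \<comment> \<open>The 1 contributed by \<open>C j\<close> is the added 1 of
    \<open>betti_sum_Union_convex\<close>.\<close>
  also have "\<dots> = of_nat (card I * 2 ^ M) + (betti_sum (\<Union>i\<in>K. C j \<inter> C i) + 1)"
    by (simp add: ac_simps)
  also have "betti_sum (\<Union>i\<in>K. C j \<inter> C i) + 1 \<le> 2 ^ card K"
    using insert.prems insert.hyps by (intro betti_sum_Union_convex) (auto simp: K_def intro: convex_Int)
  also have "(2::enat) ^ card K \<le> 2 ^ M"
    using K by (intro power_increasing) (auto simp: one_enat_def numeral_eq_enat)
  finally show ?case
    using insert.hyps by (simp add: add_left_mono algebra_simps)
qed

section \<open>Retraction onto a regular zero set\<close>

lemma C1_on_has_derivative_gradient: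
  assumes "0 < r" "C1_on (cball a r) f" "x \<in> cball a r"
  shows "(f has_derivative (\<lambda>h. gradient_within (cball a r) f x \<bullet> h)) (at x within cball a r)"
proof -
  obtain f' where f': "(f has_derivative f') (at x within cball a r)"
    using assms unfolding C1_on_def differentiable_on_def differentiable_def by blast
  \<comment> \<open>Riesz representation: the adjoint at 1 is the vector representing the
    functional, and uniqueness identifies it with the gradient.\<close>
  have "f' h = adjoint f' 1 \<bullet> h" for h
    using adjoint_works[OF has_derivative_linear[OF f'], of h 1] by (simp add: inner_commute)
  then have "f' = (\<lambda>h. adjoint f' 1 \<bullet> h)"
    by blast
  then have "(f has_derivative (\<lambda>h. adjoint f' 1 \<bullet> h)) (at x within cball a r)"
    using f' by simp
  with gradient_within_unique[OF assms(1,3) this] show ?thesis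
    by simp
qed

lemma has_derivative_gradient_lipschitz:
  fixes f :: "'a::euclidean_space \<Rightarrow> real"
  assumes "convex D" "\<And>x. x \<in> D \<Longrightarrow> (f has_derivative (\<lambda>h. g x \<bullet> h)) (at x within D)"
    and "\<And>x. x \<in> D \<Longrightarrow> norm (g x) \<le> B" "x \<in> D" "y \<in> D"
  shows "\<bar>f x - f y\<bar> \<le> B * dist x y"
proof -
  have "norm (f x - f y) \<le> B * norm (x - y)"
  proof (rule differentiable_bound[OF assms(1,2)])
    show "onorm (\<lambda>h. g z \<bullet> h) \<le> B" if "z \<in> D" for z
      using assms(3)[OF that] by (intro onorm_le) (metis Cauchy_Schwarz_ineq2 mult_right_mono norm_ge_zero order_trans real_norm_def)
  qed (use assms in auto)
  then show ?thesis
    by (simp add: dist_norm)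
qed

lemma has_derivative_gradient_linearization:
  fixes f :: "'a::euclidean_space \<Rightarrow> real"
  assumes D: "convex D" "\<And>x. x \<in> D \<Longrightarrow> (f has_derivative (\<lambda>h. g x \<bullet> h)) (at x within D)"
    and B: "\<And>z. z \<in> D \<Longrightarrow> dist z x \<le> dist y x \<Longrightarrow> norm (g z - g x) \<le> B"
    and xy: "x \<in> D" "y \<in> D"
  shows "\<bar>f y - f x - g x \<bullet> (y - x)\<bar> \<le> norm (y - x) * B"
proof -
  \<comment> \<open>This set is convex and contains the segment from \<open>x\<close> to
    \<open>y\<close>, so only gradients no farther from \<open>x\<close> than \<open>y\<close>
    matter.\<close>
  let ?S = "D \<inter> cball x (dist y x)"
  have "norm (f y - f x - g x \<bullet> (y - x)) \<le> norm (y - x) * B"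
  proof (rule differentiable_bound_linearization[where S = ?S and f' = "\<lambda>z h. g z \<bullet> h"])
    have "convex ?S"
      using D by (intro convex_Int) auto
    then show "x + t *\<^sub>R (y - x) \<in> ?S" if "t \<in> {0..1}" for t
      using xy that convexD_alt[of ?S x y t] by (auto simp: algebra_simps dist_commute)
    show "(f has_derivative (\<bullet>) (g z)) (at z within ?S)" if "z \<in> ?S" for z
      using D(2)[of z] that by (auto intro: has_derivative_subset)
    show "onorm ((\<bullet>) (g z) - (\<bullet>) (g x)) \<le> B" if "z \<in> ?S" for z
    proof -
      have "norm (g z - g x) \<le> B"
        using B[of z] that by (auto simp: dist_commute)
      then have "\<bar>(g z - g x) \<bullet> h\<bar> \<le> B * norm h" for h
        by (metis Cauchy_Schwarz_ineq2 mult_right_mono norm_ge_zero order_trans)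
      then show ?thesis
        by (intro onorm_le) (simp add: inner_diff_left)
    qed
  qed (use xy in auto)
  then show ?thesis by simp
qed

text \<open>To first order the step multiplies \<open>f x\<close> by
  \<open>1 - \<eta> * (norm (g x))\<^sup>2\<close>, at most \<open>1 - \<eta> * c\<close> for a
  positive lower bound \<open>c\<close> of the squared gradient norm. Small steps keep the
  linearization error below half of this gain.\<close>

lemma gradient_step_contracts:
  fixes f :: "'a::euclidean_space \<Rightarrow> real"
  assumes D: "convex D" "compact D" "\<And>x. x \<in> D \<Longrightarrow> (f has_derivative (\<lambda>h. g x \<bullet> h)) (at x within D)"
    and g: "continuous_on D g"
    and W: "{x \<in> D. \<bar>f x\<bar> \<le> t} \<subseteq> interior D" "\<And>x. x \<in> D \<Longrightarrow> \<bar>f x\<bar> \<le> t \<Longrightarrow> g x \<noteq> 0"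
  obtains \<eta> q where "0 < \<eta>" "0 < q" "q < 1"
    "\<And>x. x \<in> D \<Longrightarrow> \<bar>f x\<bar> \<le> t \<Longrightarrow> x - (\<eta> * f x) *\<^sub>R g x \<in> D \<and> \<bar>f (x - (\<eta> * f x) *\<^sub>R g x)\<bar> \<le> q * \<bar>f x\<bar>"
proof (cases "{x \<in> D. \<bar>f x\<bar> \<le> t} = {}")
  case True
  show ?thesis
    by (rule that[of 1 "1/2"]) (use True in auto)
next
  case False
  define W where "W = {x \<in> D. \<bar>f x\<bar> \<le> t}"
  have t: "0 \<le> t"
    using False by force
  have contf: "continuous_on D f"
    using D(3) by (meson differentiable_def differentiable_imp_continuous_on differentiable_on_def)
  have "W = D \<inter> f -` {-t..t}"
    by (auto simp: W_def)
  then have cW: "compact W"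
    using continuous_closed_preimage[OF contf compact_imp_closed[OF D(2)], of "{-t..t}"] D(2)
    by (metis closed_atLeastAtMost compact_Int_closed inf.idem inf.assoc)
  obtain x0 where x0: "x0 \<in> W" "\<And>x. x \<in> W \<Longrightarrow> norm (g x0) \<le> norm (g x)"
    using continuous_attains_inf[OF cW, of "\<lambda>x. norm (g x)"] False
      continuous_on_subset[OF g, of W] by (auto simp: W_def intro: continuous_on_norm)
  define c where "c = (norm (g x0))\<^sup>2"
  have c: "0 < c" "\<And>x. x \<in> W \<Longrightarrow> c \<le> (norm (g x))\<^sup>2"
    using x0 W(2) by (auto simp: c_def W_def intro: power_mono)
  obtain \<nu> where \<nu>: "0 < \<nu>" "\<And>x. x \<in> D \<Longrightarrow> norm (g x) \<le> \<nu>"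
    using compact_imp_bounded[OF compact_continuous_image[OF g D(2)]] unfolding bounded_pos by auto
  have "c \<le> \<nu>\<^sup>2"
    using \<nu> x0 by (auto simp: c_def W_def intro: power_mono)
  \<comment> \<open>A compact set inside the open interior has a uniform margin there, so short
    steps remain in \<open>D\<close>.\<close>
  obtain d1 where d1: "0 < d1" "\<And>x. x \<in> W \<Longrightarrow> cball x d1 \<subseteq> D"
  proof -
    obtain e where "0 < e" "(\<Union>x\<in>W. cball x e) \<subseteq> interior D"
      using compact_subset_open_imp_cball_epsilon_subset[OF cW open_interior[of D]] W(1) by (auto simp: W_def)
    then show ?thesis
      using that[of e] interior_subset by blast
  qed
  \<comment> \<open>A step has length at most \<open>\<eta> * \<bar>f x\<bar> * \<nu>\<close>; times
    this tolerance, that gives an error of at most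
    \<open>\<eta> * c / 2 * \<bar>f x\<bar>\<close>.\<close>
  obtain d2 where d2: "0 < d2" "\<And>x y. x \<in> D \<Longrightarrow> y \<in> D \<Longrightarrow> dist y x < d2 \<Longrightarrow> dist (g y) (g x) < c / (2 * \<nu>)"
    using compact_uniformly_continuous[OF g D(2)] c(1) \<nu>(1)
    unfolding uniformly_continuous_on_def by (metis divide_pos_pos mult_pos_pos zero_less_numeral)
  \<comment> \<open>The first bound keeps the first-order factor nonnegative, the second keeps steps
    shorter than \<open>d1\<close> and \<open>d2\<close>; \<open>t + 1\<close> avoids division by
    zero at \<open>t = 0\<close>.\<close>
  define \<eta> where "\<eta> = min (1 / \<nu>\<^sup>2) (min d1 d2 / (2 * (t + 1) * \<nu>))"
  have "0 < min d1 d2 / (2 * (t + 1) * \<nu>)"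
    using \<nu>(1) t d1(1) d2(1) by (intro divide_pos_pos mult_pos_pos) auto
  then have \<eta>: "0 < \<eta>"
    using \<nu>(1) by (simp add: \<eta>_def)
  have "\<eta> * \<nu>\<^sup>2 \<le> 1 / \<nu>\<^sup>2 * \<nu>\<^sup>2"
    unfolding \<eta>_def by (intro mult_right_mono) auto
  then have \<eta>\<nu>: "\<eta> * \<nu>\<^sup>2 \<le> 1"
    using \<nu>(1) by simp
  have "\<eta> * t * \<nu> \<le> (min d1 d2 / (2 * (t + 1) * \<nu>)) * t * \<nu>"
    using t \<nu> by (intro mult_right_mono) (auto simp: \<eta>_def)
  also have "\<dots> = min d1 d2 * (t / (2 * (t + 1)))"
    using \<nu>(1) by simp
  also have "\<dots> < min d1 d2 * 1"
    using t d1 d2 by (intro mult_strict_left_mono) auto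
  finally have \<eta>d: "\<eta> * t * \<nu> < min d1 d2"
    by simp
  have "\<eta> * c \<le> 1"
    using \<eta> \<eta>\<nu> \<open>c \<le> \<nu>\<^sup>2\<close> by (meson mult_left_mono less_imp_le order_trans)
  show ?thesis
  proof (rule that[of \<eta> "1 - \<eta> * c / 2"])
    show "0 < \<eta>" "0 < 1 - \<eta> * c / 2" "1 - \<eta> * c / 2 < 1"
      using \<eta> c \<open>\<eta> * c \<le> 1\<close> by auto
    fix x assume x: "x \<in> D" "\<bar>f x\<bar> \<le> t"
    then have xW: "x \<in> W" by (simp add: W_def)
    define y where "y = x - (\<eta> * f x) *\<^sub>R g x"
    have yx: "y - x = - (\<eta> * f x) *\<^sub>R g x"
      by (simp add: y_def)
    have n: "norm (y - x) = \<eta> * \<bar>f x\<bar> * norm (g x)"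
      using \<eta> by (simp add: yx abs_mult)
    also have "\<dots> \<le> \<eta> * t * \<nu>"
      using \<eta> t x \<nu> by (intro mult_mono mult_left_mono) auto
    finally have dyx: "dist y x < min d1 d2"
      using \<eta>d by (simp add: dist_norm)
    then have yD: "y \<in> D"
      using d1(2)[OF xW] by (auto simp: dist_commute)
    have "\<bar>f y - f x - g x \<bullet> (y - x)\<bar> \<le> norm (y - x) * (c / (2 * \<nu>))"
    proof (rule has_derivative_gradient_linearization[OF D(1,3) _ x(1) yD])
      show "norm (g z - g x) \<le> c / (2 * \<nu>)" if "z \<in> D" "dist z x \<le> dist y x" for z
        using d2(2)[OF x(1) that(1)] that dyx by (simp add: dist_norm)
    qed
    also have "\<dots> \<le> (\<eta> * \<bar>f x\<bar> * \<nu>) * (c / (2 * \<nu>))"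
      unfolding n using \<eta> c \<nu> x by (intro mult_right_mono mult_left_mono) auto
    also have "\<dots> = \<eta> * c / 2 * \<bar>f x\<bar>"
      using \<nu> by simp
    also have "g x \<bullet> (y - x) = - \<eta> * f x * (norm (g x))\<^sup>2"
      by (simp add: yx power2_norm_eq_inner)
    finally have "\<bar>f y - f x * (1 - \<eta> * (norm (g x))\<^sup>2)\<bar> \<le> \<eta> * c / 2 * \<bar>f x\<bar>"
      by (simp add: algebra_simps)
    moreover have "\<bar>f x * (1 - \<eta> * (norm (g x))\<^sup>2)\<bar> \<le> \<bar>f x\<bar> * (1 - \<eta> * c)"
    proof -
      have "\<eta> * (norm (g x))\<^sup>2 \<le> \<eta> * \<nu>\<^sup>2"
        using \<eta> \<nu>(2)[OF x(1)] by (intro mult_left_mono power_mono) auto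
      moreover have "\<eta> * c \<le> \<eta> * (norm (g x))\<^sup>2"
        using \<eta> c(2)[OF xW] by (intro mult_left_mono) auto
      ultimately show ?thesis
        using \<eta>\<nu> by (auto simp: abs_mult intro!: mult_left_mono)
    qed
    ultimately have "\<bar>f y\<bar> \<le> \<eta> * c / 2 * \<bar>f x\<bar> + \<bar>f x\<bar> * (1 - \<eta> * c)"
      by linarith
    also have "\<dots> = (1 - \<eta> * c / 2) * \<bar>f x\<bar>"
      by (simp add: algebra_simps)
    finally have "\<bar>f y\<bar> \<le> (1 - \<eta> * c / 2) * \<bar>f x\<bar>" .
    then show "x - (\<eta> * f x) *\<^sub>R g x \<in> D \<and>
        \<bar>f (x - (\<eta> * f x) *\<^sub>R g x)\<bar> \<le> (1 - \<eta> * c / 2) * \<bar>f x\<bar>"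
      using yD by (simp add: y_def)
  qed
qed

text \<open>The retraction is the limit of the iterates of the step \<open>x \<mapsto> x - \<eta> f(x) \<nabla>f(x)\<close>,
  a discrete gradient descent for \<open>f\<^sup>2/2\<close>. Unlike a gradient flow, it needs no
  regularity of the gradient beyond continuity.\<close>

lemma zero_set_retract_of_sublevel:
  fixes f :: "'a::euclidean_space \<Rightarrow> real"
  assumes D: "convex D" "compact D" "\<And>x. x \<in> D \<Longrightarrow> (f has_derivative (\<lambda>h. g x \<bullet> h)) (at x within D)"
    and g: "continuous_on D g"
    and W: "{x \<in> D. \<bar>f x\<bar> \<le> t} \<subseteq> interior D" "\<And>x. x \<in> D \<Longrightarrow> \<bar>f x\<bar> \<le> t \<Longrightarrow> g x \<noteq> 0"
    and t: "0 \<le> t"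
  shows "zero_set D f retract_of {x \<in> D. \<bar>f x\<bar> \<le> t}"
proof -
  define W where "W = {x \<in> D. \<bar>f x\<bar> \<le> t}"
  obtain \<eta> q where \<eta>: "0 < \<eta>" and q: "0 < q" "q < 1" and step:
    "\<And>x. x \<in> D \<Longrightarrow> \<bar>f x\<bar> \<le> t \<Longrightarrow> x - (\<eta> * f x) *\<^sub>R g x \<in> D \<and> \<bar>f (x - (\<eta> * f x) *\<^sub>R g x)\<bar> \<le> q * \<bar>f x\<bar>"
    using gradient_step_contracts[OF D g assms(5,6)] by metis
  define \<phi> where "\<phi> x = x - (\<eta> * f x) *\<^sub>R g x" for x
  have contf: "continuous_on D f"
    using D(3) by (meson differentiable_def differentiable_imp_continuous_on differentiable_on_def)
  have "W = D \<inter> f -` {-t..t}"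
    by (auto simp: W_def)
  then have clW: "closed W"
    using continuous_closed_preimage[OF contf compact_imp_closed[OF D(2)], of "{-t..t}"] by simp
  obtain \<nu> where \<nu>: "0 < \<nu>" "\<And>x. x \<in> D \<Longrightarrow> norm (g x) \<le> \<nu>"
    using compact_imp_bounded[OF compact_continuous_image[OF g D(2)]] unfolding bounded_pos by auto
  have \<phi>W: "\<phi> x \<in> W" "\<bar>f (\<phi> x)\<bar> \<le> q * \<bar>f x\<bar>" if "x \<in> W" for x
  proof -
    have "q * \<bar>f x\<bar> \<le> 1 * \<bar>f x\<bar>"
      using q by (intro mult_right_mono) auto
    then show "\<phi> x \<in> W" "\<bar>f (\<phi> x)\<bar> \<le> q * \<bar>f x\<bar>"
      using step[of x] that by (auto simp: W_def \<phi>_def)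
  qed
  have contW: "continuous_on W f" "continuous_on W g"
    by (rule continuous_on_subset[OF contf], force simp: W_def) (rule continuous_on_subset[OF g], force simp: W_def)
  then have cont\<phi>: "continuous_on W \<phi>"
    unfolding \<phi>_def by (intro continuous_intros)
  have iter: "(\<phi> ^^ n) x \<in> W" "\<bar>f ((\<phi> ^^ n) x)\<bar> \<le> q ^ n * t" if "x \<in> W" for x n
  proof -
    have "(\<phi> ^^ n) x \<in> W \<and> \<bar>f ((\<phi> ^^ n) x)\<bar> \<le> q ^ n * t"
    proof (induction n)
      case 0
      then show ?case using that by (simp add: W_def)
    next
      case (Suc n)
      have "\<bar>f (\<phi> ((\<phi> ^^ n) x))\<bar> \<le> q * \<bar>f ((\<phi> ^^ n) x)\<bar>"
        using \<phi>W Suc by blast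
      also have "\<dots> \<le> q * (q ^ n * t)"
        using Suc q by (intro mult_left_mono) auto
      finally show ?case
        using \<phi>W Suc by (simp add: mult.assoc)
    qed
    then show "(\<phi> ^^ n) x \<in> W" "\<bar>f ((\<phi> ^^ n) x)\<bar> \<le> q ^ n * t"
      by auto
  qed
  have contiter: "continuous_on W (\<phi> ^^ n)" for n
  proof (induction n)
    case (Suc n)
    have "continuous_on W (\<phi> \<circ> (\<phi> ^^ n))"
      using Suc iter by (intro continuous_on_compose continuous_on_subset[OF cont\<phi>]) auto
    then show ?case by simp
  qed (simp add: id_def)
  \<comment> \<open>Writing the limit of the iterates as a series of increments makes the
    Weierstrass test available.\<close>
  define u where "u n x = (\<phi> ^^ Suc n) x - (\<phi> ^^ n) x" for n x
  define L where "L x = x + suminf (\<lambda>n. u n x)" for x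
  have u: "norm (u n x) \<le> \<eta> * t * \<nu> * q ^ n" if "x \<in> W" for n x
  proof -
    have "norm (u n x) = \<eta> * \<bar>f ((\<phi> ^^ n) x)\<bar> * norm (g ((\<phi> ^^ n) x))"
      using \<eta> by (simp add: u_def \<phi>_def abs_mult)
    also have "\<dots> \<le> \<eta> * (q ^ n * t) * \<nu>"
      using \<eta> q t iter[OF that, of n] \<nu>(2)[of "(\<phi> ^^ n) x"]
      by (intro mult_mono mult_left_mono) (auto simp: W_def)
    finally show ?thesis
      by (simp add: ac_simps)
  qed
  have telescope: "x + (\<Sum>i<n. u i x) = (\<phi> ^^ n) x" for n x
    unfolding u_def by (subst sum_lessThan_telescope) simp
  \<comment> \<open>The increments have a geometric majorant independent of the point, so the limit
    is continuous.\<close>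
  have unif: "uniform_limit W (\<lambda>n x. \<Sum>i<n. u i x) (\<lambda>x. suminf (\<lambda>i. u i x)) sequentially"
    using u q by (intro Weierstrass_m_test[where M = "\<lambda>n. \<eta> * t * \<nu> * q ^ n"] summable_mult summable_geometric) auto
  have "continuous_on W (\<lambda>x. suminf (\<lambda>i. u i x))"
  proof (rule uniform_limit_theorem[OF _ unif])
    have "continuous_on W (u i)" for i
      unfolding u_def by (intro continuous_intros contiter)
    then show "\<forall>\<^sub>F n in sequentially. continuous_on W (\<lambda>x. \<Sum>i<n. u i x)"
      by (intro always_eventually allI continuous_on_sum) auto
  qed simp
  then have contL: "continuous_on W L"
    unfolding L_def by (intro continuous_intros)
  have lim: "(\<lambda>n. (\<phi> ^^ n) x) \<longlonglongrightarrow> L x" if "x \<in> W" for x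
  proof -
    have "(\<lambda>n. x + (\<Sum>i<n. u i x)) \<longlonglongrightarrow> L x"
      unfolding L_def using tendsto_uniform_limitI[OF unif that] by (intro tendsto_intros)
    then show ?thesis
      by (simp add: telescope)
  qed
  have LW: "L x \<in> W" if "x \<in> W" for x
    using closed_sequentially[OF clW _ lim[OF that]] iter[OF that] by blast
  have fL: "f (L x) = 0" if "x \<in> W" for x
  proof -
    have "(\<lambda>n. f ((\<phi> ^^ n) x)) \<longlonglongrightarrow> f (L x)"
      using contW(1) lim[OF that] iter[OF that] LW[OF that]
      by (intro continuous_on_tendsto_compose[of W f]) auto
    moreover have "(\<lambda>n. f ((\<phi> ^^ n) x)) \<longlonglongrightarrow> 0"
    proof (rule Lim_null_comparison)
      show "\<forall>\<^sub>F n in sequentially. norm (f ((\<phi> ^^ n) x)) \<le> q ^ n * t"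
        using iter[OF that] by simp
      show "(\<lambda>n. q ^ n * t) \<longlonglongrightarrow> 0"
        using q by (intro tendsto_mult_left_zero LIMSEQ_realpow_zero) auto
    qed
    ultimately show ?thesis
      by (rule LIMSEQ_unique)
  qed
  \<comment> \<open>Zeros of \<open>f\<close> are fixed by every step.\<close>
  have "L x = x" if "f x = 0" for x
  proof -
    have "\<phi> x = x"
      using that by (simp add: \<phi>_def)
    moreover from this have "(\<phi> ^^ n) x = x" for n
      by (induction n) auto
    ultimately show ?thesis
      by (simp add: L_def u_def)
  qed
  then have "retraction W (zero_set D f) L"
    using t LW fL contL by (auto simp: retraction_def zero_set_def W_def)
  then show ?thesis
    by (auto simp: retract_of_def W_def)
qed

section \<open>Covering the zero set by balls\<close>

text \<open>Balls of radius \<open>s / 2\<close> around the points are disjoint and lie in a ball of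
  radius \<open>R + s / 2\<close>; compare volumes.\<close>

lemma card_separated_le:
  fixes S :: "'a::euclidean_space set"
  assumes fin: "finite S" and sub: "S \<subseteq> cball a R" and R: "0 \<le> R" and s: "0 < s"
    and sep: "pairwise (\<lambda>x y. s \<le> dist x y) S"
  shows "real (card S) \<le> ((2 * R + s) / s) ^ DIM('a)"
proof -
  let ?V = "unit_ball_vol (real DIM('a))"
  have disj: "pairwise (\<lambda>x y. disjnt (ball x (s / 2)) (ball y (s / 2))) S"
  proof (rule pairwise_mono[OF sep])
    fix x y :: 'a assume "s \<le> dist x y"
    then have "z \<notin> ball y (s / 2)" if "z \<in> ball x (s / 2)" for z
      using that dist_triangle[of x y z] by (auto simp: dist_commute)
    then show "disjnt (ball x (s / 2)) (ball y (s / 2))"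
      by (auto simp: disjnt_iff)
  qed simp
  have V: "0 < ?V"
    by simp
  have "real (card S) * (?V * (s / 2) ^ DIM('a)) = (\<Sum>x\<in>S. measure lebesgue (ball x (s / 2)))"
    using s by (simp add: content_ball)
  also have "\<dots> = measure lebesgue (\<Union>x\<in>S. ball x (s / 2))"
    using fin disj by (intro measure_UNION'[symmetric]) auto
  also have "\<dots> \<le> measure lebesgue (ball a (R + s / 2))"
  proof (rule measure_mono_fmeasurable)
    show "(\<Union>x\<in>S. ball x (s / 2)) \<subseteq> ball a (R + s / 2)"
    proof clarify
      fix x y assume "x \<in> S" "y \<in> ball x (s / 2)"
      then have "dist a x \<le> R" "dist x y < s / 2"
        using sub by auto
      then show "y \<in> ball a (R + s / 2)"
        using dist_triangle[of a y x] by simp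
    qed
  qed (use fin in auto)
  also have "\<dots> = ?V * (R + s / 2) ^ DIM('a)"
    using R s by (simp add: content_ball)
  finally have "real (card S) * (s / 2) ^ DIM('a) \<le> (R + s / 2) ^ DIM('a)"
    using V by (simp add: mult.left_commute)
  then have "real (card S) \<le> ((R + s / 2) / (s / 2)) ^ DIM('a)"
    unfolding power_divide using s by (subst pos_le_divide_eq) (simp, simp only: power_divide)
  also have "(R + s / 2) / (s / 2) = (2 * R + s) / s"
    using s by (simp add: field_simps)
  finally show ?thesis .
qed

text \<open>The packing bound yields a separated subset of largest cardinality. A point missed by
  its balls could be added to it.\<close>

lemma separated_net_exists:
  fixes Z :: "'a::euclidean_space set"
  assumes Z: "Z \<subseteq> cball a R" and R: "0 \<le> R" and s: "0 < s"
  obtains S where "finite S" "S \<subseteq> Z" "pairwise (\<lambda>x y. s \<le> dist x y) S" "Z \<subseteq> (\<Union>x\<in>S. ball x s)"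
proof -
  let ?P = "\<lambda>S. finite S \<and> S \<subseteq> Z \<and> pairwise (\<lambda>x y. s \<le> dist x y) S"
  have bound: "card S \<le> nat \<lfloor>((2 * R + s) / s) ^ DIM('a)\<rfloor>" if "?P S" for S
    using card_separated_le[OF _ _ R s, of S a] that Z by (intro le_nat_floor) blast
  have "\<exists>S. ?P S \<and> (\<forall>T. ?P T \<longrightarrow> card T \<le> card S)"
    by (rule ex_has_greatest_nat[of ?P "{}" card "Suc (nat \<lfloor>((2 * R + s) / s) ^ DIM('a)\<rfloor>)"])
      (use bound in \<open>auto simp: less_Suc_eq_le\<close>)
  then obtain S where S: "?P S" and max: "\<And>T. ?P T \<Longrightarrow> card T \<le> card S"
    by blast
  have "Z \<subseteq> (\<Union>x\<in>S. ball x s)"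
  proof
    fix z assume z: "z \<in> Z"
    show "z \<in> (\<Union>x\<in>S. ball x s)"
    proof (rule ccontr)
      assume "z \<notin> (\<Union>x\<in>S. ball x s)"
      then have far: "s \<le> dist x z" if "x \<in> S" for x
        using that by force
      then have "z \<notin> S"
        using s by force
      moreover have "?P (insert z S)"
        using S z far by (auto simp: pairwise_insert dist_commute)
      ultimately show False
        using max[of "insert z S"] S by simp
    qed
  qed
  then show ?thesis
    using S that by blast
qed

lemma betti_sum_separated_balls:
  fixes S :: "'a::euclidean_space set"
  assumes fin: "finite S" and s: "0 < s" and sep: "pairwise (\<lambda>x y. s \<le> dist x y) S"
  shows "betti_sum (\<Union>x\<in>S. ball x s) \<le> of_nat (card S * 2 ^ 5 ^ DIM('a))"
proof (rule betti_sum_Union_convex_bounded_overlap[OF fin, where C = "\<lambda>x. ball x s" and M = "5 ^ DIM('a)"])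
  fix y assume "y \<in> S"
  let ?T = "{x \<in> S. ball x s \<inter> ball y s \<noteq> {}}"
  have "?T \<subseteq> cball y (2 * s)"
  proof
    fix x assume "x \<in> ?T"
    then obtain z where "z \<in> ball x s" "z \<in> ball y s"
      by auto
    then show "x \<in> cball y (2 * s)"
      using dist_triangle[of y x z] by (auto simp: dist_commute)
  qed
  \<comment> \<open>Centres of balls meeting the ball at \<open>y\<close> lie within
    \<open>2 * s\<close> of \<open>y\<close>; the packing bound then gives the base 5.\<close>
  then have "real (card ?T) \<le> ((2 * (2 * s) + s) / s) ^ DIM('a)"
    using fin sep s by (intro card_separated_le[where a = y]) (auto intro: pairwise_subset)
  also have "(2 * (2 * s) + s) / s = 5"
    using s by (simp add: field_simps)
  finally show "card ?T \<le> 5 ^ DIM('a)"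
    by (metis of_nat_le_iff of_nat_numeral of_nat_power)
qed auto

lemma betti_sum_neighbourhood_retract_le:
  fixes Z W :: "'a::euclidean_space set"
  assumes Z: "Z retract_of W" "Z \<subseteq> cball a R" and R: "0 \<le> R" and s: "0 < s" and W: "\<And>z. z \<in> Z \<Longrightarrow> ball z s \<subseteq> W"
  shows "ereal_of_enat (betti_sum Z) \<le> ereal (2 ^ 5 ^ DIM('a) * ((2 * R + s) / s) ^ DIM('a))"
proof -
  obtain S where S: "finite S" "S \<subseteq> Z" "pairwise (\<lambda>x y. s \<le> dist x y) S" "Z \<subseteq> (\<Union>x\<in>S. ball x s)"
    using separated_net_exists[OF Z(2) R s] by blast
  have "betti_sum Z \<le> betti_sum (\<Union>x\<in>S. ball x s)"
  proof (rule betti_sum_retract)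
    \<comment> \<open>The union lies between \<open>Z\<close> and \<open>W\<close>, so the
      retraction of \<open>W\<close> restricts to it.\<close>
    show "Z retract_of (\<Union>x\<in>S. ball x s)"
      using S W by (intro retract_of_subset[OF Z(1)]) auto
  qed
  also have "\<dots> \<le> of_nat (card S * 2 ^ 5 ^ DIM('a))"
    by (rule betti_sum_separated_balls[OF S(1) s S(3)])
  finally have "ereal_of_enat (betti_sum Z) \<le> ereal_of_enat (of_nat (card S * 2 ^ 5 ^ DIM('a)))"
    by (simp only: ereal_of_enat_le_iff)
  also have "\<dots> = ereal (2 ^ 5 ^ DIM('a) * real (card S))"
    by (simp add: of_nat_eq_enat mult.commute)
  also have "\<dots> \<le> ereal (2 ^ 5 ^ DIM('a) * ((2 * R + s) / s) ^ DIM('a))"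
    using card_separated_le[OF S(1) _ R s S(3), of a] S(2) Z(2) by simp
  finally show ?thesis .
qed

section \<open>Estimates for one function in terms of its condition number\<close>

locale regular_function =
  fixes a :: "'a::euclidean_space" and r :: real and f :: "'a \<Rightarrow> real"
  assumes r: "0 < r" and C1: "C1_on (cball a r) f" and regular: "regular_zero_set (cball a r) f"
    and interior: "zero_set (cball a r) f \<subseteq> interior (cball a r)"
begin

abbreviation "D \<equiv> cball a r"
abbreviation "g \<equiv> gradient_within D f"
abbreviation "jet x \<equiv> sqrt (\<bar>f x\<bar>\<^sup>2 + (norm (g x))\<^sup>2)"

lemma deriv: "x \<in> D \<Longrightarrow> (f has_derivative (\<lambda>h. g x \<bullet> h)) (at x within D)"
  using C1_on_has_derivative_gradient[OF r C1] .

lemma continuous: "continuous_on D f" "continuous_on D g" "continuous_on D jet"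
proof -
  show *: "continuous_on D f" "continuous_on D g"
    using C1 by (auto simp: C1_on_def intro: differentiable_imp_continuous_on)
  show "continuous_on D jet"
    by (intro continuous_intros *)
qed

lemma jet_le_nu1: "x \<in> D \<Longrightarrow> jet x \<le> nu1 f D"
  unfolding nu1_def
  by (intro cSUP_upper bounded_imp_bdd_above compact_imp_bounded compact_continuous_image continuous) auto

lemma gradient_le_nu1: "x \<in> D \<Longrightarrow> norm (g x) \<le> nu1 f D"
  using jet_le_nu1[of x] real_sqrt_sum_squares_ge2[of "norm (g x)" "\<bar>f x\<bar>"] by linarith

lemma delta_le_jet: "x \<in> D \<Longrightarrow> delta f D \<le> jet x"
  unfolding delta_def by (intro cINF_lower bdd_belowI2[where m = 0]) auto

text \<open>By compactness the infimum is attained, and regularity excludes a common zero of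
  \<open>f\<close> and its gradient.\<close>

lemma delta_pos: "0 < delta f D"
proof -
  obtain x where x: "x \<in> D" "\<And>y. y \<in> D \<Longrightarrow> jet x \<le> jet y"
    using continuous_attains_inf[OF compact_cball _ continuous(3)] r by auto
  have "\<bar>f x\<bar>\<^sup>2 + (norm (g x))\<^sup>2 \<noteq> 0"
    using regular x by (auto simp: sum_power2_eq_zero_iff regular_zero_set_def zero_set_def)
  then have "0 < jet x"
    by (simp add: order_less_le)
  also have "jet x \<le> delta f D"
    unfolding delta_def using x r by (intro cINF_greatest) auto
  finally show ?thesis .
qed

lemma delta_le_nu1: "delta f D \<le> nu1 f D"
  using delta_le_jet[of a] jet_le_nu1[of a] r by simp

lemma boundary_min_le: "x \<in> frontier D \<Longrightarrow> boundary_min f D \<le> \<bar>f x\<bar>"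
  unfolding boundary_min_def by (intro cINF_lower bdd_belowI2[where m = 0]) auto

text \<open>The minimum over the compact frontier is attained, and every zero of \<open>f\<close> is
  interior.\<close>

lemma boundary_min_pos: "0 < boundary_min f D"
proof -
  have fr: "frontier D \<noteq> {}" "compact (frontier D)" "frontier D \<subseteq> D"
    using r by (auto simp: frontier_cball)
  obtain x where x: "x \<in> frontier D" "\<And>y. y \<in> frontier D \<Longrightarrow> \<bar>f x\<bar> \<le> \<bar>f y\<bar>"
    using continuous_attains_inf[OF fr(2,1) continuous_on_rabs[OF continuous_on_subset[OF continuous(1) fr(3)]]]
    by blast
  have "f x \<noteq> 0"
    using interior x fr(3) by (auto simp: zero_set_def frontier_def)
  then have "0 < \<bar>f x\<bar>"
    by simp
  also have "\<bar>f x\<bar> \<le> boundary_min f D"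
    unfolding boundary_min_def using x fr by (intro cINF_greatest) auto
  finally show ?thesis .
qed

lemma kappa1_ge_1: "1 \<le> kappa1 f D"
  using delta_pos boundary_min_pos delta_le_nu1 by (simp add: kappa1_def)

lemma zero_set_retract:
  assumes t: "0 \<le> t" "t < min (boundary_min f D) (delta f D)"
  shows "zero_set D f retract_of {x \<in> D. \<bar>f x\<bar> \<le> t}"
proof (rule zero_set_retract_of_sublevel[OF convex_cball compact_cball deriv continuous(2)])
  show "{x \<in> D. \<bar>f x\<bar> \<le> t} \<subseteq> interior D"
  proof clarify
    fix x assume x: "x \<in> D" "\<bar>f x\<bar> \<le> t"
    then have "x \<notin> frontier D"
      using boundary_min_le[of x] t by force
    then show "x \<in> interior D"
      using x closure_subset by (auto simp: frontier_def)
  qed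
  \<comment> \<open>If the gradient vanished, \<open>jet x\<close> would equal
    \<open>\<bar>f x\<bar>\<close>, which is below \<open>delta f D\<close>.\<close>
  show "g x \<noteq> 0" if "x \<in> D" "\<bar>f x\<bar> \<le> t" for x
    using delta_le_jet[of x] that t by auto
qed (use t in auto)

text \<open>The Lipschitz bound is available only inside \<open>D\<close>, so the ball must also be
  kept there. If it left \<open>D\<close>, connectedness would give a frontier point in the ball,
  where \<open>f\<close> is both too large and too small.\<close>

lemma ball_zero_subset_sublevel:
  assumes z: "z \<in> zero_set D f" and s: "nu1 f D * s \<le> t" "t < boundary_min f D"
  shows "ball z s \<subseteq> {x \<in> D. \<bar>f x\<bar> \<le> t}"
proof
  fix y assume y: "y \<in> ball z s"
  have zD: "z \<in> D" "f z = 0"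
    using z by (auto simp: zero_set_def)
  have small: "\<bar>f x\<bar> \<le> t" if "x \<in> D" "x \<in> ball z s" for x
  proof -
    have "\<bar>f x - f z\<bar> \<le> nu1 f D * dist x z"
      using has_derivative_gradient_lipschitz[OF convex_cball deriv gradient_le_nu1 that(1) zD(1)] .
    also have "\<dots> \<le> nu1 f D * s"
      using that delta_pos delta_le_nu1 by (intro mult_left_mono) (auto simp: dist_commute)
    finally show ?thesis
      using s zD by simp
  qed
  have "y \<in> D"
  proof (rule ccontr)
    assume "y \<notin> D"
    moreover have "z \<in> ball z s"
      using y le_less_trans[OF zero_le_dist[of z y]] by simp
    ultimately obtain x where x: "x \<in> ball z s" "x \<in> frontier D"
      using connected_Int_frontier[of "ball z s" D] zD(1) y by blast
    moreover from this have "x \<in> D"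
      using closed_cball frontier_subset_closed by blast
    ultimately show False
      using small[of x] boundary_min_le[of x] s by simp
  qed
  then show "y \<in> {x \<in> D. \<bar>f x\<bar> \<le> t}"
    using small y by simp
qed

lemma betti_sum_zero_set_le:
  "ereal_of_enat (betti_sum (zero_set D f))
    \<le> ereal (2 ^ 5 ^ DIM('a) * (4 * r + 1) ^ DIM('a) * kappa1 f D ^ DIM('a))"
proof -
  define m where "m = min (boundary_min f D) (delta f D)"
  have m: "0 < m"
    using delta_pos boundary_min_pos by (simp add: m_def)
  have \<kappa>: "1 \<le> kappa1 f D" "kappa1 f D = nu1 f D / m"
    using kappa1_ge_1 by (auto simp: kappa1_def m_def)
  have \<nu>: "0 < nu1 f D"
    using delta_pos delta_le_nu1 by linarith
  \<comment> \<open>This is 1 / (2 * kappa1), chosen so that \<open>f\<close> stays within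
    \<open>m / 2\<close> on the balls, strictly below both thresholds.\<close>
  define s where "s = m / (2 * nu1 f D)"
  have s: "0 < s"
    using m \<nu> by (simp add: s_def)
  have "ereal_of_enat (betti_sum (zero_set D f)) \<le> ereal (2 ^ 5 ^ DIM('a) * ((2 * r + s) / s) ^ DIM('a))"
  proof (rule betti_sum_neighbourhood_retract_le[OF zero_set_retract _ less_imp_le[OF r] s ball_zero_subset_sublevel])
    show "nu1 f D * s \<le> m / 2"
      using \<nu> by (simp add: s_def)
  qed (use m in \<open>auto simp: zero_set_def m_def\<close>)
  also have "(2 * r + s) / s = 4 * r * kappa1 f D + 1"
    using m \<nu> by (simp add: s_def \<kappa>(2) field_simps)
  \<comment> \<open>Since the condition number is at least 1, it absorbs the summand 1 and a pure
    power remains.\<close>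
  also have "ereal (2 ^ 5 ^ DIM('a) * (4 * r * kappa1 f D + 1) ^ DIM('a))
    \<le> ereal (2 ^ 5 ^ DIM('a) * ((4 * r + 1) * kappa1 f D) ^ DIM('a))"
    using \<kappa>(1) r by (simp add: power_mono distrib_right)
  finally show ?thesis
    by (simp add: power_mult_distrib mult.assoc)
qed

end

theorem theorem183:
  fixes D :: "(real ^ 'n) set" and a :: "real ^ 'n" and r :: real
  assumes "0 < r" and "D = cball a r"
  shows "\<exists>c1 :: real. 0 < c1 \<and>
    (\<forall>f :: real ^ 'n \<Rightarrow> real.
       C1_on D f \<longrightarrow> regular_zero_set D f \<longrightarrow> zero_set D f \<subseteq> interior D \<longrightarrow>
       ereal_of_enat (betti_sum (zero_set D f)) \<le> ereal (c1 * kappa1 f D ^ CARD('n)))"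
proof (intro exI conjI allI impI)
  \<comment> \<open>The constant depends only on the radius and the dimension.\<close>
  let ?c = "2 ^ 5 ^ CARD('n) * (4 * r + 1) ^ CARD('n)"
  show "0 < ?c"
    using assms(1) by simp
  fix f :: "real ^ 'n \<Rightarrow> real"
  assume "C1_on D f" "regular_zero_set D f" "zero_set D f \<subseteq> interior D"
  then interpret regular_function a r f
    using assms by unfold_locales auto
  show "ereal_of_enat (betti_sum (zero_set D f)) \<le> ereal (?c * kappa1 f D ^ CARD('n))"
    using betti_sum_zero_set_le assms(2) by simp
qed

end
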